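(* There is a 0-dimensional $e$-separable space $X$ such that $$\mathfrak{c}=d(X)<d_e(X)=e(X)=w(X)=2^{\mathfrak{c}}.$$
   Context: All topological spaces are assumed to be $T_1$; 0-dimensional means having a base of clopen sets. A subset of $X$ is $\sigma$-closed-discrete if it is the union of countably many closed discrete subsets of $X$. A space $X$ is $e$-separable if it has a dense $\sigma$-closed-discrete subset. $d(X)$ is the smallest cardinality of a dense subset of $X$. For an $e$-separable space $X$, $d_e(X)=\min\{|E|: E \text{ is a dense } \sigma\text{-closed-discrete subset of } X\}$. The extent $e(X)$ is the supremum of the cardinalities of closed discrete subsets of $X$. $w(X)$ is the weight of $X$ (the smallest cardinality of a base). $\mathfrak{c}=2^{\aleph_0}$. *)

theory Defs
  imports "HOL-Analysis.Analysis"
begin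

unbundle cardinal_syntax

definition base_of :: "'a topology \<Rightarrow> 'a set set \<Rightarrow> bool" where
  "base_of X \<B> \<longleftrightarrow>
     (\<forall>V\<in>\<B>. openin X V) \<and>
     (\<forall>U x. openin X U \<and> x \<in> U \<longrightarrow> (\<exists>V\<in>\<B>. x \<in> V \<and> V \<subseteq> U))"

definition zero_dimensional :: "'a topology \<Rightarrow> bool" where
  "zero_dimensional X \<longleftrightarrow> (\<exists>\<B>. base_of X \<B> \<and> (\<forall>V\<in>\<B>. closedin X V))"

definition dense_subset :: "'a topology \<Rightarrow> 'a set \<Rightarrow> bool" where
  "dense_subset X D \<longleftrightarrow> D \<subseteq> topspace X \<and> X closure_of D = topspace X"

definition closed_discrete :: "'a topology \<Rightarrow> 'a set \<Rightarrow> bool" where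
  "closed_discrete X D \<longleftrightarrow> closedin X D \<and> subtopology X D = discrete_topology D"

definition sigma_closed_discrete :: "'a topology \<Rightarrow> 'a set \<Rightarrow> bool" where
  "sigma_closed_discrete X E \<longleftrightarrow>
     (\<exists>\<D>. countable \<D> \<and> (\<forall>D\<in>\<D>. closed_discrete X D) \<and> E = \<Union>\<D>)"

definition e_separable :: "'a topology \<Rightarrow> bool" where
  "e_separable X \<longleftrightarrow> (\<exists>E. dense_subset X E \<and> sigma_closed_discrete X E)"

text \<open>
  The smallest cardinality of a member of a family of sets. As in the distribution's cardinal
  library, cardinals are represented by the well-orders \<open>|A|\<close> and compared with
  \<open>=o\<close>, \<open>\<le>o\<close> and \<open><o\<close>; the choice below is unique
  up to \<open>=o\<close>. The value is meaningful only if the family is nonempty.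
\<close>

definition least_card :: "'b set set \<Rightarrow> 'b rel" where
  "least_card \<A> = |SOME A. A \<in> \<A> \<and> (\<forall>B\<in>\<A>. |A| \<le>o |B| )|"

lemma least_card_spec:
  assumes "\<A> \<noteq> {}"
  shows "\<exists>A\<in>\<A>. least_card \<A> = |A|" and "\<And>B. B \<in> \<A> \<Longrightarrow> least_card \<A> \<le>o |B|"
proof -
  have "\<exists>r\<in>card_of ` \<A>. \<forall>r'\<in>card_of ` \<A>. r \<le>o r'"
    using assms by (intro exists_minim_Card_order) (auto simp: card_of_Card_order)
  then have "\<exists>A. A \<in> \<A> \<and> (\<forall>B\<in>\<A>. |A| \<le>o |B| )"
    by auto
  from someI_ex[OF this]
  show "\<exists>A\<in>\<A>. least_card \<A> = |A|" and "\<And>B. B \<in> \<A> \<Longrightarrow> least_card \<A> \<le>o |B|"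
    unfolding least_card_def by blast+
qed

definition top_density :: "'a topology \<Rightarrow> 'a rel" where
  "top_density X = least_card {D. dense_subset X D}"

text \<open>Intended for e-separable spaces only: otherwise the family below is empty.\<close>

definition e_density :: "'a topology \<Rightarrow> 'a rel" where
  "e_density X = least_card {E. dense_subset X E \<and> sigma_closed_discrete X E}"

definition top_weight :: "'a topology \<Rightarrow> 'a set rel" where
  "top_weight X = least_card {\<B>. base_of X \<B>}"

text \<open>
  The supremum of the cardinalities of closed discrete subsets, i.e. their least upper bound among
  cardinals. Only cardinals of subsets of the type need to be considered, because the
  cardinality of \<open>topspace X\<close> is an upper bound and every smaller cardinal is that of
  one of its subsets.
\<close>

definition top_extent :: "'a topology \<Rightarrow> 'a rel" where
  "top_extent X = least_card {B. \<forall>D. closed_discrete X D \<longrightarrow> |D| \<le>o |B|}"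

text \<open>The cardinal \<open>2^\<aleph>\<^sub>0\<close>; \<open>natLeq\<close> is \<open>\<aleph>\<^sub>0\<close>.\<close>

abbreviation continuum :: "(nat \<Rightarrow> bool) rel" where
  "continuum \<equiv> ctwo ^c natLeq"

text \<open>
  HOL cannot quantify existentially over types, so a space whose existence is asserted needs a
  carrier type fixed in advance (the underlying set \<open>topspace X\<close> may be any subset of it).
  The type below has \<open>2^2^\<cc>\<close> elements. This is no restriction for spaces of weight at
  most \<open>2^\<cc>\<close>: a \<open>T\<^sub>1\<close> (indeed \<open>T\<^sub>0\<close>) space of weight
  \<open>\<kappa>\<close> has at most \<open>2^\<kappa>\<close> points, since a point is determined by the members
  of a base that contain it.
\<close>

type_synonym point = "real set \<Rightarrow> bool"

end

(*
  The points are functions from the 2^c sets of reals to truth values. For each n, the functions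
  that differ from a fixed background function at exactly n coordinates form a closed discrete set
  as soon as those with fewer deviations are left out, and backgrounds that differ pairwise at
  infinitely many coordinates make the union of these sets dense. A countably compact dense set of
  only c points is added: it meets every closed discrete set in a finite set, so that a
  sigma-closed-discrete set contains only countably many of its points. A sigma-closed-discrete set
  of size less than 2^c thus restricts to countably many functions once fewer than 2^c coordinates
  are dropped; these do not separate the remaining coordinates, so the set is not dense.
*)

theory Submission
  imports Defs
begin

section \<open>Cardinals\<close>

lemma least_card_ordIso:
  assumes "A \<in> \<A>" and "\<And>B. B \<in> \<A> \<Longrightarrow> |A| \<le>o |B|"
  shows "least_card \<A> =o |A|"
proof -
  obtain B where "B \<in> \<A>" "least_card \<A> = |B|"
    using least_card_spec(1) assms(1) by blast
  moreover have "least_card \<A> \<le>o |A|"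
    using least_card_spec(2) assms(1) by blast
  ultimately show ?thesis
    using assms(2) by (simp add: ordIso_iff_ordLeq)
qed

lemma card_of_Un_ordLeq:
  assumes "infinite C" and "|A| \<le>o |C|" and "|B| \<le>o |C|"
  shows "|A \<union> B| \<le>o |C|"
proof (rule Un_Cinfinite_bound[OF assms(2,3)])
  show "Cinfinite |C|"
    using assms(1) card_of_card_order_on by (simp add: cinfinite_def Field_card_of)
qed

text \<open>A set of size \<open>n + 1\<close> arises by inserting an element into one of size
  \<open>n\<close>, so k * k = k bounds the sets of each size, and there are only countably many
  sizes.\<close>

lemma card_of_finite_subsets:
  assumes "infinite (UNIV :: 'a set)"
  shows "|{F :: 'a set. finite F}| \<le>o |UNIV :: 'a set|"
proof -
  have n: "|{F :: 'a set. finite F \<and> card F = n}| \<le>o |UNIV :: 'a set|" for n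
  proof (induction n)
    case 0
    have "{F :: 'a set. finite F \<and> card F = 0} = {{}}"
      by auto
    then show ?case
      by (simp add: card_of_singl_ordLeq)
  next
    case (Suc n)
    let ?S = "{F :: 'a set. finite F \<and> card F = n}"
    have "{F :: 'a set. finite F \<and> card F = Suc n} \<subseteq> (\<lambda>(a, F). insert a F) ` (UNIV \<times> ?S)"
      by (fastforce simp: card_Suc_eq_finite)
    then have "|{F :: 'a set. finite F \<and> card F = Suc n}| \<le>o |(UNIV :: 'a set) \<times> ?S|"
      by (meson card_of_image card_of_mono1 ordLeq_transitive)
    also have "|(UNIV :: 'a set) \<times> ?S| \<le>o |UNIV :: 'a set|"
      using Suc assms by (intro card_of_Sigma_ordLeq_infinite) (auto intro: ordLeq_refl card_of_Card_order)
    finally show ?case .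
  qed
  have "{F :: 'a set. finite F} = (\<Union>n. {F. finite F \<and> card F = n})"
    by auto
  moreover have "|\<Union>n. {F :: 'a set. finite F \<and> card F = n}| \<le>o |UNIV :: 'a set|"
    using n assms by (intro card_of_UNION_ordLeq_infinite) (auto simp: infinite_iff_card_of_nat)
  ultimately show ?thesis
    by simp
qed

lemma card_of_reals: "|UNIV :: real set| =o |UNIV :: nat set set|"
  using nat_sets_eqpoll_reals eqpoll_iff_card_of_ordIso eqpoll_sym by blast

lemma continuum_ordIso_reals: "continuum =o |UNIV :: real set|"
proof -
  have "|Pow (UNIV :: nat set)| =o continuum"
    using card_of_Pow_Func[of "UNIV :: nat set"] by (simp add: cexp_def ctwo_def Field_natLeq Field_card_of)
  then show ?thesis
    using card_of_reals by (metis Pow_UNIV ordIso_symmetric ordIso_transitive)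
qed

lemma ctwo_cexp_continuum_ordIso: "ctwo ^c continuum =o |UNIV :: real set set|"
proof -
  have "ctwo ^c continuum =o ctwo ^c |UNIV :: real set|"
    by (intro cexp_cong2 continuum_ordIso_reals Card_order_ctwo Card_order_cexp card_of_Card_order)
  moreover have "|Pow (UNIV :: real set)| =o ctwo ^c |UNIV :: real set|"
    using card_of_Pow_Func[of "UNIV :: real set"] by (simp add: cexp_def ctwo_def Field_card_of)
  ultimately show ?thesis
    by (metis Pow_UNIV ordIso_symmetric ordIso_transitive)
qed

lemma infinite_real_sets: "infinite (UNIV :: real set set)"
  by (simp add: Finite_Set.finite_set infinite_UNIV_char_0)

lemma card_of_reals_ordLess: "|UNIV :: real set| <o |UNIV :: real set set|"
  using card_of_Pow[of "UNIV :: real set"] by simp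

section \<open>Closed discrete sets\<close>

text \<open>One local test covers both properties: at points outside \<open>C\<close> it gives
  closedness, at points of \<open>C\<close> discreteness.\<close>

lemma closed_discrete_iff:
  "closed_discrete X C \<longleftrightarrow>
     C \<subseteq> topspace X \<and> (\<forall>x\<in>topspace X. \<exists>U. openin X U \<and> x \<in> U \<and> U \<inter> C \<subseteq> {x})"
proof (intro iffI conjI ballI)
  assume C: "closed_discrete X C"
  then show sub: "C \<subseteq> topspace X"
    by (simp add: closed_discrete_def closedin_subset)
  fix x assume x: "x \<in> topspace X"
  show "\<exists>U. openin X U \<and> x \<in> U \<and> U \<inter> C \<subseteq> {x}"
  proof (cases "x \<in> C")
    case True
    then have "openin (subtopology X C) {x}"
      using C by (simp add: closed_discrete_def)
    then show ?thesis
      by (auto simp: openin_subtopology)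
  next
    case False
    have "openin X (topspace X - C)"
      using C by (simp add: closed_discrete_def closedin_def)
    then show ?thesis
      using False x by (intro exI[of _ "topspace X - C"]) auto
  qed
next
  assume R: "C \<subseteq> topspace X \<and> (\<forall>x\<in>topspace X. \<exists>U. openin X U \<and> x \<in> U \<and> U \<inter> C \<subseteq> {x})"
  have "\<exists>U. openin X U \<and> x \<in> U \<and> U \<subseteq> topspace X - C" if x: "x \<in> topspace X - C" for x
  proof -
    obtain U where "openin X U" "x \<in> U" "U \<inter> C \<subseteq> {x}"
      using R x by (meson DiffD1)
    then show ?thesis
      using x openin_subset[of X U] by (intro exI[of _ U]) auto
  qed
  then have "openin X (topspace X - C)"
    by (subst openin_subopen) blast
  then have "closedin X C"
    using R by (simp add: closedin_def)
  moreover have "openin (subtopology X C) {x}" if x: "x \<in> C" for x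
  proof -
    obtain U where "openin X U" "x \<in> U" "U \<inter> C \<subseteq> {x}"
      using R x by (meson subsetD)
    then have "{x} = U \<inter> C"
      using x by blast
    then show ?thesis
      using \<open>openin X U\<close> by (auto simp: openin_subtopology)
  qed
  then have "subtopology X C = discrete_topology C"
    using R by (auto simp: discrete_topology_unique eq_commute[of "subtopology X C"] Int_absorb1)
  ultimately show "closed_discrete X C"
    by (simp add: closed_discrete_def)
qed

text \<open>Each point of \<open>C\<close> has a base member that meets \<open>C\<close> in this
  point only, and such members differ for different points.\<close>

lemma card_of_closed_discrete_ordLeq_base:
  assumes "closed_discrete X C" and "base_of X \<B>"
  shows "|C| \<le>o |\<B>|"
proof -
  have C: "C \<subseteq> topspace X" "\<forall>x\<in>topspace X. \<exists>U. openin X U \<and> x \<in> U \<and> U \<inter> C \<subseteq> {x}"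
    using assms(1) by (simp_all add: closed_discrete_iff)
  have "\<exists>V\<in>\<B>. x \<in> V \<and> V \<inter> C \<subseteq> {x}" if x: "x \<in> C" for x
  proof -
    obtain U where "openin X U" "x \<in> U" "U \<inter> C \<subseteq> {x}"
      using C x by blast
    moreover from this obtain V where "V \<in> \<B>" "x \<in> V" "V \<subseteq> U"
      using assms(2) by (meson base_of_def)
    ultimately show ?thesis
      by (intro bexI[of _ V]) auto
  qed
  then obtain V where V: "\<And>x. x \<in> C \<Longrightarrow> V x \<in> \<B> \<and> x \<in> V x \<and> V x \<inter> C \<subseteq> {x}"
    by metis
  then have "inj_on V C"
    by (intro inj_onI) blast
  then show ?thesis
    using V by (intro card_of_ordLeqI) auto
qed

lemma dense_subset_iff:
  "dense_subset X S \<longleftrightarrow> S \<subseteq> topspace X \<and> (\<forall>U. openin X U \<and> U \<noteq> {} \<longrightarrow> S \<inter> U \<noteq> {})"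
  by (auto simp: dense_subset_def dense_intersects_open)

section \<open>A countably compact dense subset of size continuum\<close>

text \<open>For finite \<open>F\<close>, these are the basic neighbourhoods of \<open>x\<close> in
  the Cantor cube of weight 2^c.\<close>

definition cylinder :: "real set set \<Rightarrow> point \<Rightarrow> point set" where
  "cylinder F x = {y. \<forall>A\<in>F. y A = x A}"

definition accumulates :: "point set \<Rightarrow> point \<Rightarrow> bool" where
  "accumulates S y \<longleftrightarrow> (\<forall>F. finite F \<longrightarrow> (\<exists>z\<in>S. z \<noteq> y \<and> z \<in> cylinder F y))"

text \<open>Tychonoff's theorem makes the cube compact, so the Bolzano-Weierstrass property
  applies.\<close>

lemma exists_accumulates:
  assumes "infinite S"
  shows "\<exists>y. accumulates S y"
proof -
  let ?P = "product_topology (\<lambda>_ :: real set. discrete_topology (UNIV :: bool set)) UNIV"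
  have "compact_space ?P"
    by (simp add: compact_space_product_topology compact_space_discrete_topology)
  then obtain y where y: "y \<in> ?P derived_set_of S"
    using compactin_imp_Bolzano_Weierstrass[of ?P UNIV S] assms by (auto simp: compact_space_def)
  have "openin ?P (cylinder F y)" if "finite F" for F
  proof -
    have eq: "cylinder F y = PiE UNIV (\<lambda>A. if A \<in> F then {y A} else UNIV)"
      by (auto simp: cylinder_def PiE_def Pi_def split: if_splits)
    have "finite {A. (if A \<in> F then {y A} else UNIV) \<noteq> UNIV}"
      using that by (rule finite_subset[rotated]) auto
    then show ?thesis
      unfolding eq openin_PiE_gen by auto
  qed
  moreover have "y \<in> cylinder F y" for F
    by (simp add: cylinder_def)
  ultimately have "accumulates S y"
    using y unfolding accumulates_def in_derived_set_of by blast
  then show ?thesis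
    by blast
qed

text \<open>
  A single infinitary operation serves two purposes: on sequences with infinite range it provides
  accumulation points, on all others it is the Boolean operation nand of the first two terms.
\<close>

definition join :: "(nat \<Rightarrow> point) \<Rightarrow> point" where
  "join s = (if infinite (range s) then SOME y. accumulates (range s) y
             else (\<lambda>A. \<not> (s 0 A \<and> s 1 A)))"

text \<open>Terms of countable arity over one generator per real. Their values form the closure of
  the generators under \<open>join\<close>, and counting terms replaces a transfinite iteration of
  this closure.\<close>

datatype tree = Leaf real | Node "nat \<Rightarrow> tree"

text \<open>The generator of \<open>r\<close> tests membership of \<open>r\<close> in the
  coordinate. Generators separate coordinates, as in the Hewitt-Marczewski-Pondiczery
  theorem.\<close>

primrec eval_tree :: "tree \<Rightarrow> point" where
  "eval_tree (Leaf r) = (\<lambda>A. r \<in> A)"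
| "eval_tree (Node f) = join (\<lambda>n. eval_tree (f n))"

text \<open>The labels of a tree are read along finite paths: \<open>None\<close> marks a leaf, the
  rationals form the Dedekind cut of its real, and a path running beyond a leaf repeats the leaf's
  value.\<close>

primrec code_tree :: "tree \<Rightarrow> nat list \<Rightarrow> rat option set" where
  "code_tree (Leaf r) = (\<lambda>p. insert None (Some ` {q. of_rat q < r}))"
| "code_tree (Node f) = (\<lambda>p. case p of [] \<Rightarrow> {} | n # q \<Rightarrow> code_tree (f n) q)"

lemma inj_code_tree: "inj code_tree"
proof (rule injI)
  show "t = u" if "code_tree t = code_tree u" for t u
    using that
  proof (induction t arbitrary: u)
    case (Leaf r)
    show ?case
    proof (cases u)
      case (Leaf s)
      have "code_tree (Leaf r) [] = code_tree (Leaf s) []"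
        using \<open>code_tree (Leaf r) = code_tree u\<close> Leaf by simp
      then have "of_rat q < r \<longleftrightarrow> of_rat q < s" for q
        by auto
      then have "r = s"
        by (metis linorder_neqE_linordered_idom of_rat_dense order_less_imp_not_less)
      then show ?thesis
        using Leaf by simp
    next
      case (Node g)
      then show ?thesis
        using fun_cong[OF \<open>code_tree (Leaf r) = code_tree u\<close>, of "[]"] by simp
    qed
  next
    case (Node f)
    show ?case
    proof (cases u)
      case (Leaf s)
      then show ?thesis
        using fun_cong[OF \<open>code_tree (Node f) = code_tree u\<close>, of "[]"] by simp
    next
      case u: (Node g)
      \<comment> \<open>Paths starting with \<open>n\<close> recover the code of the n-th
        child.\<close>
      have "code_tree (f n) = code_tree (g n)" for n
        using fun_cong[OF \<open>code_tree (Node f) = code_tree u\<close>, of "n # _"] u by auto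
      then have "f n = g n" for n
        using Node.IH by auto
      then show ?thesis
        using u by auto
    qed
  qed
qed

lemma card_of_trees: "|UNIV :: tree set| \<le>o |UNIV :: real set|"
proof -
  \<comment> \<open>A code is a set of pairs from a countable type, hence via \<open>to_nat\<close>
    a set of naturals.\<close>
  let ?h = "\<lambda>t. to_nat ` (SIGMA p : UNIV. code_tree t p)"
  have "inj ?h"
  proof (rule injI)
    fix t u assume "?h t = ?h u"
    then have eq: "(SIGMA p : UNIV. code_tree t p) = (SIGMA p : UNIV. code_tree u p)"
      by (simp add: inj_image_eq_iff)
    have "code_tree t p = code_tree u p" for p
      using arg_cong[OF eq, of "\<lambda>S. S `` {p}"] by (simp add: Image_def)
    then show "t = u"
      using injD[OF inj_code_tree] by blast
  qed
  then have "|UNIV :: tree set| \<le>o |UNIV :: nat set set|"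
    by (intro card_of_ordLeqI) auto
  then show ?thesis
    using card_of_reals ordIso_symmetric ordLeq_ordIso_trans by blast
qed

definition tree_points :: "point set" where
  "tree_points = range eval_tree"

lemma card_of_tree_points: "|tree_points| \<le>o |UNIV :: real set|"
  unfolding tree_points_def using card_of_image card_of_trees ordLeq_transitive by blast

lemma join_in_tree_points:
  assumes "range s \<subseteq> tree_points"
  shows "join s \<in> tree_points"
proof -
  have "\<forall>n. \<exists>t. s n = eval_tree t"
    using assms by (auto simp: tree_points_def)
  then obtain f where "\<And>n. s n = eval_tree (f n)"
    by metis
  then have "s = (\<lambda>n. eval_tree (f n))"
    by auto
  then have "join s = eval_tree (Node f)"
    by simp
  then show ?thesis
    unfolding tree_points_def by (metis rangeI)
qed

section \<open>Boolean operations and density of the tree points\<close>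

lemma nand_in_tree_points:
  assumes "x \<in> tree_points" "y \<in> tree_points"
  shows "(\<lambda>A. \<not> (x A \<and> y A)) \<in> tree_points"
proof -
  \<comment> \<open>The sequence x, y, y, ... has finite range, so \<open>join\<close> takes its
    nand branch.\<close>
  let ?s = "\<lambda>n :: nat. if n = 0 then x else y"
  have "finite (range ?s)"
    by (rule finite_subset[of _ "{x, y}"]) auto
  then have "join ?s = (\<lambda>A. \<not> (x A \<and> y A))"
    by (simp add: join_def)
  then show ?thesis
    using join_in_tree_points[of ?s] assms by (auto split: if_splits)
qed

lemma neg_in_tree_points: "x \<in> tree_points \<Longrightarrow> (\<lambda>A. \<not> x A) \<in> tree_points"
  using nand_in_tree_points[of x x] by simp

lemma conj_in_tree_points:
  "x \<in> tree_points \<Longrightarrow> y \<in> tree_points \<Longrightarrow> (\<lambda>A. x A \<and> y A) \<in> tree_points"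
  using neg_in_tree_points[OF nand_in_tree_points[of x y]] by simp

lemma disj_in_tree_points:
  "x \<in> tree_points \<Longrightarrow> y \<in> tree_points \<Longrightarrow> (\<lambda>A. x A \<or> y A) \<in> tree_points"
  using nand_in_tree_points[OF neg_in_tree_points[of x] neg_in_tree_points[of y]] by simp

lemma mem_in_tree_points: "(\<lambda>A. r \<in> A) \<in> tree_points"
  unfolding tree_points_def by (metis eval_tree.simps(1) rangeI)

text \<open>Some real lies in exactly one of \<open>A\<close> and a given \<open>B\<close>; its
  generator or the negation holds at \<open>A\<close> and fails at \<open>B\<close>. Finitely many
  such functions are conjoined.\<close>

lemma tree_points_isolate:
  assumes "finite G"
  shows "\<exists>d\<in>tree_points. d A \<and> (\<forall>B\<in>G - {A}. \<not> d B)"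
  using assms
proof (induction G)
  case empty
  have "(\<lambda>B :: real set. 0 \<in> B \<or> \<not> 0 \<in> B) \<in> tree_points"
    using disj_in_tree_points[OF mem_in_tree_points neg_in_tree_points[OF mem_in_tree_points]] .
  then show ?case
    by (intro bexI) auto
next
  case (insert B G)
  then obtain d where d: "d \<in> tree_points" "d A" "\<forall>B\<in>G - {A}. \<not> d B"
    by blast
  show ?case
  proof (cases "A = B")
    case True
    then show ?thesis
      using d by auto
  next
    case False
    then obtain r where r: "r \<in> A \<longleftrightarrow> r \<notin> B"
      by blast
    define e where "e = (\<lambda>C. if r \<in> A then r \<in> C else r \<notin> C)"
    have "e \<in> tree_points"
      using mem_in_tree_points neg_in_tree_points[OF mem_in_tree_points]
      unfolding e_def by (cases "r \<in> A") auto
    then have "(\<lambda>C. d C \<and> e C) \<in> tree_points"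
      using d conj_in_tree_points by blast
    then show ?thesis
      using d r by (intro bexI[of _ "\<lambda>C. d C \<and> e C"]) (auto simp: e_def)
  qed
qed

text \<open>Coordinates are corrected one at a time: a function true at the new coordinate and false
  at the old ones is joined to, or subtracted from, the function found so far.\<close>

lemma tree_points_meet_cylinder:
  assumes "finite F"
  shows "tree_points \<inter> cylinder F x \<noteq> {}"
  using assms
proof (induction F)
  case empty
  then show ?case
    using mem_in_tree_points by (auto simp: cylinder_def)
next
  case (insert A F)
  then obtain d where d: "d \<in> tree_points" "\<forall>B\<in>F. d B = x B"
    by (auto simp: cylinder_def)
  obtain e where e: "e \<in> tree_points" "e A" "\<forall>B\<in>F - {A}. \<not> e B"
    using tree_points_isolate insert.hyps by blast
  let ?y = "if x A then (\<lambda>B. d B \<or> e B) else (\<lambda>B. d B \<and> \<not> e B)"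
  have "?y \<in> tree_points"
    using d e disj_in_tree_points conj_in_tree_points neg_in_tree_points by simp
  moreover have "?y \<in> cylinder (insert A F) x"
    using d e insert.hyps by (auto simp: cylinder_def)
  ultimately show ?case
    by blast
qed

text \<open>An injective sequence in \<open>S\<close> has infinite range, so \<open>join\<close>
  yields an accumulation point that is again the value of a tree.\<close>

lemma tree_points_countably_compact:
  assumes "S \<subseteq> tree_points" and "infinite S"
  shows "\<exists>y\<in>tree_points. accumulates S y"
proof -
  obtain s :: "nat \<Rightarrow> point" where s: "inj s" "range s \<subseteq> S"
    using infinite_countable_subset assms(2) by blast
  then have inf: "infinite (range s)"
    using finite_imageD by blast
  then have "accumulates (range s) (join s)"
    using exists_accumulates[OF inf] by (simp add: join_def someI_ex)
  then have "accumulates S (join s)"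
    using s by (meson accumulates_def subsetD)
  then show ?thesis
    using join_in_tree_points assms s by blast
qed

text \<open>
  The invariant that keeps tree points away from the dense \<open>\<sigma>\<close>-closed-discrete set:
  it survives accumulation points of sequences, because a countable union of countable
  exceptional sets is countable.
\<close>

lemma tree_points_eventually_constant:
  assumes "x \<in> tree_points"
  shows "\<exists>N. countable N \<and> (\<forall>r\<in>-N. \<forall>s\<in>-N. x {r} = x {s})"
proof -
  have "\<exists>N. countable N \<and> (\<forall>r\<in>-N. \<forall>s\<in>-N. eval_tree t {r} = eval_tree t {s})" for t
  proof (induction t)
    case (Leaf a)
    then show ?case
      by (intro exI[of _ "{a}"]) auto
  next
    case (Node f)
    then have "\<forall>n. \<exists>N. countable N \<and> (\<forall>r\<in>-N. \<forall>s\<in>-N. eval_tree (f n) {r} = eval_tree (f n) {s})"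
      by blast
    then obtain N where N: "\<And>n. countable (N n)"
      "\<And>n r s. r \<notin> N n \<Longrightarrow> s \<notin> N n \<Longrightarrow> eval_tree (f n) {r} = eval_tree (f n) {s}"
      by (metis ComplI)
    let ?x = "\<lambda>n. eval_tree (f n)"
    have "join ?x {r} = join ?x {s}" if rs: "r \<notin> (\<Union>n. N n)" "s \<notin> (\<Union>n. N n)" for r s
    proof (cases "infinite (range ?x)")
      case True
      then have "accumulates (range ?x) (join ?x)"
        using exists_accumulates[OF True] by (simp add: join_def someI_ex)
      \<comment> \<open>A cylinder over both coordinates gives a single term agreeing with the
        accumulation point at \<open>{r}\<close> and \<open>{s}\<close>; no term distinguishes these
        two.\<close>
      then obtain n where "?x n \<in> cylinder {{r}, {s}} (join ?x)"
        unfolding accumulates_def by (metis (no_types, lifting) finite.emptyI finite.insertI imageE)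
      then have "?x n {r} = join ?x {r}" "?x n {s} = join ?x {s}"
        unfolding cylinder_def by blast+
      moreover have "?x n {r} = ?x n {s}"
        using N(2)[of r n s] rs by blast
      ultimately show ?thesis
        by simp
    next
      case False
      have "?x n {r} = ?x n {s}" for n
        using N(2)[of r n s] rs by blast
      then show ?thesis
        using False by (simp add: join_def)
    qed
    then have "\<forall>r\<in>-(\<Union>n. N n). \<forall>s\<in>-(\<Union>n. N n). join ?x {r} = join ?x {s}"
      by blast
    moreover have "countable (\<Union>n. N n)"
      using N(1) by simp
    ultimately show ?case
      unfolding eval_tree.simps by blast
  qed
  moreover obtain t where "x = eval_tree t"
    using assms unfolding tree_points_def by blast
  ultimately show ?thesis
    by blast
qed

section \<open>The space\<close>

text \<open>On singletons \<open>{r}\<close> this is a step function with its jump at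
  \<open>n\<close>. Hence two backgrounds differ at every \<open>{r}\<close> with \<open>r\<close>
  strictly between the jumps, and none is constant on singletons off a countable set.\<close>

definition background :: "nat \<Rightarrow> point" where
  "background n A \<longleftrightarrow> (\<exists>r\<in>A. real n < r)"

definition flip :: "nat \<Rightarrow> real set set \<Rightarrow> point" where
  "flip n G = (\<lambda>A. background n A \<noteq> (A \<in> G))"

definition deviation :: "nat \<Rightarrow> point \<Rightarrow> real set set" where
  "deviation n x = {A. x A \<noteq> background n A}"

text \<open>The index is both the number of the background and the exact number of deviations.
  Points with fewer than \<open>n\<close> deviations from background \<open>n\<close> therefore lie
  in no layer at all.\<close>

definition layer :: "nat \<Rightarrow> point set" where
  "layer n = flip n ` {G. finite G \<and> card G = n}"

lemma deviation_flip [simp]: "deviation n (flip n G) = G"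
  by (auto simp: deviation_def flip_def)

lemma flip_deviation [simp]: "flip n (deviation n x) = x"
  by (auto simp: deviation_def flip_def)

lemma inj_flip: "inj (flip n)"
  by (metis deviation_flip injI)

lemma layer_iff: "x \<in> layer n \<longleftrightarrow> finite (deviation n x) \<and> card (deviation n x) = n"
proof
  assume "finite (deviation n x) \<and> card (deviation n x) = n"
  then show "x \<in> layer n"
    unfolding layer_def by (intro image_eqI[of _ _ "deviation n x"]) auto
qed (auto simp: layer_def)

section \<open>Finite and infinite sets of deviations\<close>

lemma infinite_singletons:
  assumes "infinite R" and "\<And>r :: real. r \<in> R \<Longrightarrow> {r} \<in> S"
  shows "infinite S"
proof
  assume "finite S"
  moreover have "(\<lambda>r. {r}) ` R \<subseteq> S"
    using assms(2) by blast
  ultimately have "finite ((\<lambda>r. {r}) ` R)"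
    by (rule finite_subset[rotated])
  then show False
    using assms(1) by (auto dest: finite_imageD)
qed

text \<open>Off a countable set of singletons \<open>x\<close> has one value, while the background
  is false to the left of \<open>n\<close> and true to the right; on one of the two sides they
  disagree.\<close>

lemma infinite_deviation_tree_point:
  assumes "x \<in> tree_points"
  shows "infinite (deviation n x)"
proof -
  obtain N where N: "countable N" "\<forall>r\<in>-N. \<forall>s\<in>-N. x {r} = x {s}"
    using tree_points_eventually_constant[OF assms] by blast
  have inf: "infinite ({a<..<b} - N)" if "a < b" for a b :: real
    using N(1) that uncountable_open_interval uncountable_minus_countable uncountable_infinite by metis
  let ?R = "{real n<..<real n + 1} - N" and ?L = "{real n - 1<..<real n} - N"
  have "infinite ?L"
    by (rule inf) simp
  then obtain s where s: "s \<in> ?L"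
    using infinite_imp_nonempty by blast
  show ?thesis
  proof (cases "x {s}")
    case True
    show ?thesis
    proof (rule infinite_singletons)
      show "infinite ?L"
        by fact
      show "{r} \<in> deviation n x" if "r \<in> ?L" for r
      proof -
        have "x {r} = x {s}"
          using that N(2) s by blast
        then show ?thesis
          using that True by (simp add: deviation_def background_def)
      qed
    qed
  next
    case False
    show ?thesis
    proof (rule infinite_singletons)
      show "infinite ?R"
        by (rule inf) simp
      show "{r} \<in> deviation n x" if "r \<in> ?R" for r
      proof -
        have "x {r} = x {s}"
          using that N(2) s by blast
        then show ?thesis
          using that False by (simp add: deviation_def background_def)
      qed
    qed
  qed
qed

lemma infinite_deviation_background:
  assumes "m \<noteq> n"
  shows "infinite (deviation m (background n))"
proof (rule infinite_singletons)
  show "infinite {real (min m n)<..<real (max m n)}"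
    using assms by (auto simp: min_def max_def)
  show "{r} \<in> deviation m (background n)" if "r \<in> {real (min m n)<..<real (max m n)}" for r
    using that by (auto simp: deviation_def background_def min_def max_def split: if_splits)
qed

text \<open>Finitely many deviations from both backgrounds would make the backgrounds themselves
  differ at only finitely many coordinates.\<close>

lemma infinite_deviation_other_layer:
  assumes "finite (deviation n x)" and "m \<noteq> n"
  shows "infinite (deviation m x)"
proof
  assume "finite (deviation m x)"
  then have "finite (deviation n x \<union> deviation m x)"
    using assms by simp
  moreover have "deviation m (background n) \<subseteq> deviation n x \<union> deviation m x"
    by (auto simp: deviation_def)
  ultimately show False
    using infinite_deviation_background[OF assms(2)] finite_subset by blast
qed

text \<open>Copying \<open>x\<close> on \<open>F\<close> costs at most \<open>card F\<close>
  deviations; the missing ones are placed outside \<open>F\<close>.\<close>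

lemma layer_meets_cylinder:
  assumes "finite F"
  shows "layer (card F) \<inter> cylinder F x \<noteq> {}"
proof -
  let ?n = "card F"
  let ?K = "F \<inter> deviation ?n x"
  have "infinite (- F)"
    using assms infinite_real_sets by (simp add: Compl_eq_Diff_UNIV)
  then obtain G where G: "G \<subseteq> - F" "finite G" "card G = ?n - card ?K"
    using infinite_arbitrarily_large by metis
  have "card (?K \<union> G) = card ?K + card G"
    using G assms by (intro card_Un_disjoint) auto
  also have "\<dots> = ?n"
    using G(3) assms card_mono[of F ?K] by simp
  finally have "flip ?n (?K \<union> G) \<in> layer ?n"
    using G assms by (simp add: layer_iff)
  moreover have "flip ?n (?K \<union> G) \<in> cylinder F x"
    using G by (auto simp: cylinder_def flip_def deviation_def)
  ultimately show ?thesis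
    by blast
qed

definition core :: "point set" where
  "core = tree_points \<union> (\<Union>n. layer n)"

text \<open>
  The points below become isolated in the space. They are there only to force density at least
  continuum: a subspace of a power of the two-point space has countable cellularity, and
  \<open>2\<^sup>\<lambda> = 2\<^sup>\<cc>\<close> is consistent for some \<open>\<lambda> < \<cc>\<close>.
\<close>

definition isolated_points :: "point set" where
  "isolated_points = range (\<lambda>r. flip 2 {{r}})"

text \<open>A single deviation from background 2 is finite, which excludes tree points and the other
  layers, and it is one short of what layer 2 demands.\<close>

lemma core_disjoint_isolated: "core \<inter> isolated_points = {}"
proof -
  have "flip 2 {{r}} \<notin> core" for r
  proof
    assume "flip 2 {{r}} \<in> core"
    then obtain n where n: "flip 2 {{r}} \<in> layer n"
      using infinite_deviation_tree_point[of "flip 2 {{r}}" 2] by (auto simp: core_def)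
    then have "n = 2"
      using infinite_deviation_other_layer[of 2 "flip 2 {{r}}" n] by (auto simp: layer_iff)
    then show False
      using n by (simp add: layer_iff)
  qed
  then show ?thesis
    by (auto simp: isolated_points_def)
qed

text \<open>
  The topological sum of \<open>core\<close>, as a subspace of the Cantor cube of weight \<open>2\<^sup>\<cc>\<close>,
  and a discrete space.
\<close>

definition sum_space :: "point topology" where
  "sum_space = topology (\<lambda>U. U \<subseteq> core \<union> isolated_points \<and>
     (\<forall>x\<in>U \<inter> core. \<exists>F. finite F \<and> cylinder F x \<inter> core \<subseteq> U))"

lemma openin_sum_space:
  "openin sum_space U \<longleftrightarrow> U \<subseteq> core \<union> isolated_points \<and>
     (\<forall>x\<in>U \<inter> core. \<exists>F. finite F \<and> cylinder F x \<inter> core \<subseteq> U)"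
proof -
  have "istopology (\<lambda>U. U \<subseteq> core \<union> isolated_points \<and>
     (\<forall>x\<in>U \<inter> core. \<exists>F. finite F \<and> cylinder F x \<inter> core \<subseteq> U))"
    unfolding istopology_def
  proof (intro conjI allI impI ballI)
    fix S T x
    assume S: "S \<subseteq> core \<union> isolated_points \<and>
        (\<forall>x\<in>S \<inter> core. \<exists>F. finite F \<and> cylinder F x \<inter> core \<subseteq> S)"
      and T: "T \<subseteq> core \<union> isolated_points \<and>
        (\<forall>x\<in>T \<inter> core. \<exists>F. finite F \<and> cylinder F x \<inter> core \<subseteq> T)"
    then show "S \<inter> T \<subseteq> core \<union> isolated_points"
      by blast
    assume "x \<in> S \<inter> T \<inter> core"
    then obtain F G where "finite F" "cylinder F x \<inter> core \<subseteq> S" "finite G" "cylinder G x \<inter> core \<subseteq> T"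
      using S T by (metis IntD1 IntD2 IntI)
    then show "\<exists>F. finite F \<and> cylinder F x \<inter> core \<subseteq> S \<inter> T"
      by (intro exI[of _ "F \<union> G"]) (auto simp: cylinder_def)
  next
    fix \<U> x
    assume U: "\<forall>U\<in>\<U>. U \<subseteq> core \<union> isolated_points \<and>
        (\<forall>x\<in>U \<inter> core. \<exists>F. finite F \<and> cylinder F x \<inter> core \<subseteq> U)"
    then show "\<Union>\<U> \<subseteq> core \<union> isolated_points"
      by blast
    assume "x \<in> \<Union>\<U> \<inter> core"
    then obtain U where "U \<in> \<U>" "x \<in> U \<inter> core"
      by blast
    then obtain F where "finite F" "cylinder F x \<inter> core \<subseteq> U"
      using U by meson
    then show "\<exists>F. finite F \<and> cylinder F x \<inter> core \<subseteq> \<Union>\<U>"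
      using \<open>U \<in> \<U>\<close> by blast
  qed
  then show ?thesis
    unfolding sum_space_def by (simp add: topology_inverse')
qed

lemma topspace_sum_space: "topspace sum_space = core \<union> isolated_points"
proof
  show "topspace sum_space \<subseteq> core \<union> isolated_points"
    using openin_topspace[of sum_space] unfolding openin_sum_space by blast
  have "openin sum_space (core \<union> isolated_points)"
    unfolding openin_sum_space by (auto intro!: exI[of _ "{}"])
  then show "core \<union> isolated_points \<subseteq> topspace sum_space"
    by (rule openin_subset)
qed

section \<open>Separation and a clopen base\<close>

lemma openin_cylinder:
  assumes "finite F"
  shows "openin sum_space (cylinder F x \<inter> core)"
  unfolding openin_sum_space
proof (intro conjI ballI)
  fix y assume "y \<in> cylinder F x \<inter> core \<inter> core"
  then show "\<exists>F'. finite F' \<and> cylinder F' y \<inter> core \<subseteq> cylinder F x \<inter> core"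
    using assms by (intro exI[of _ F]) (auto simp: cylinder_def)
qed auto

lemma closedin_cylinder:
  assumes "finite F"
  shows "closedin sum_space (cylinder F x \<inter> core)"
  unfolding closedin_def topspace_sum_space openin_sum_space
proof (intro conjI ballI)
  fix y assume "y \<in> (core \<union> isolated_points - cylinder F x \<inter> core) \<inter> core"
  then show "\<exists>F'. finite F' \<and> cylinder F' y \<inter> core \<subseteq> core \<union> isolated_points - cylinder F x \<inter> core"
    using assms by (intro exI[of _ F]) (auto simp: cylinder_def)
qed auto

lemma openin_isolated: "x \<in> isolated_points \<Longrightarrow> openin sum_space {x}"
  using core_disjoint_isolated by (auto simp: openin_sum_space)

lemma openin_sum_space_meets:
  assumes "openin sum_space U" "U \<noteq> {}" "isolated_points \<inter> U = {}"
  obtains F x where "finite F" "cylinder F x \<inter> core \<subseteq> U"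
  using assms unfolding openin_sum_space by blast

lemma t1_sum_space: "t1_space sum_space"
  unfolding t1_space_def
proof (intro ballI impI)
  fix x y assume x: "x \<in> topspace sum_space" and "y \<in> topspace sum_space" "x \<noteq> y"
  show "\<exists>U. openin sum_space U \<and> x \<in> U \<and> y \<notin> U"
  proof (cases "x \<in> isolated_points")
    case True
    then show ?thesis
      using openin_isolated \<open>x \<noteq> y\<close> by blast
  next
    case False
    obtain A where A: "x A \<noteq> y A"
      using \<open>x \<noteq> y\<close> by blast
    have "x \<in> cylinder {A} x \<inter> core" "y \<notin> cylinder {A} x \<inter> core"
      using A x False by (auto simp: topspace_sum_space cylinder_def)
    then show ?thesis
      using openin_cylinder[of "{A}" x] by blast
  qed
qed

lemma closedin_isolated: "x \<in> isolated_points \<Longrightarrow> closedin sum_space {x}"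
  using t1_sum_space by (simp add: t1_space_closedin_singleton topspace_sum_space)

definition clopen_base :: "point set set" where
  "clopen_base = {cylinder F x \<inter> core | F x. finite F} \<union> (\<lambda>x. {x}) ` isolated_points"

lemma base_of_clopen_base: "base_of sum_space clopen_base"
  unfolding base_of_def
proof (intro conjI ballI allI impI)
  fix V assume "V \<in> clopen_base"
  then show "openin sum_space V"
    using openin_cylinder openin_isolated by (auto simp: clopen_base_def)
next
  fix U x assume U: "openin sum_space U \<and> x \<in> U"
  show "\<exists>V\<in>clopen_base. x \<in> V \<and> V \<subseteq> U"
  proof (cases "x \<in> isolated_points")
    case True
    then show ?thesis
      using U by (intro bexI[of _ "{x}"]) (auto simp: clopen_base_def)
  next
    case False
    then have "x \<in> core"
      using U openin_sum_space by blast
    then obtain F where "finite F" "cylinder F x \<inter> core \<subseteq> U"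
      using U openin_sum_space by (meson IntI)
    then show ?thesis
      using \<open>x \<in> core\<close>
      by (intro bexI[of _ "cylinder F x \<inter> core"]) (auto simp: clopen_base_def cylinder_def)
  qed
qed

lemma zero_dimensional_sum_space: "zero_dimensional sum_space"
  using base_of_clopen_base closedin_cylinder closedin_isolated
  unfolding zero_dimensional_def by (intro exI[of _ clopen_base]) (auto simp: clopen_base_def)

lemma closed_discrete_isolated: "closed_discrete sum_space isolated_points"
  unfolding closed_discrete_iff topspace_sum_space
proof (intro conjI ballI)
  fix x assume x: "x \<in> core \<union> isolated_points"
  show "\<exists>U. openin sum_space U \<and> x \<in> U \<and> U \<inter> isolated_points \<subseteq> {x}"
  proof (cases "x \<in> isolated_points")
    case True
    then show ?thesis
      using openin_isolated by blast
  next
    case False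
    then show ?thesis
      using x core_disjoint_isolated openin_cylinder[of "{}" x]
      by (intro exI[of _ "cylinder {} x \<inter> core"]) (auto simp: cylinder_def)
  qed
qed simp

text \<open>
  The closure of a layer in the whole cube adds only points that deviate from its background at
  fewer coordinates, and none of these belong to the space.
\<close>

lemma closed_discrete_layer: "closed_discrete sum_space (layer n)"
  unfolding closed_discrete_iff topspace_sum_space
proof (intro conjI ballI)
  show "layer n \<subseteq> core \<union> isolated_points"
    by (auto simp: core_def)
  fix x assume x: "x \<in> core \<union> isolated_points"
  show "\<exists>U. openin sum_space U \<and> x \<in> U \<and> U \<inter> layer n \<subseteq> {x}"
  proof (cases "x \<in> isolated_points")
    case True
    then show ?thesis
      using openin_isolated by blast
  next
    case False
    then have core: "x \<in> core"
      using x by blast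
    have "\<exists>F. finite F \<and> cylinder F x \<inter> layer n \<subseteq> {x}"
    proof (cases "x \<in> layer n")
      case True
      \<comment> \<open>A \<open>y\<close> agreeing with \<open>x\<close> on the deviations of
        \<open>x\<close> deviates there as well, and having equally many deviations it has no
        others.\<close>
      have "y = x" if y: "y \<in> cylinder (deviation n x) x" "y \<in> layer n" for y
      proof -
        have "deviation n x \<subseteq> deviation n y"
          using y(1) by (auto simp: cylinder_def deviation_def)
        then have "deviation n x = deviation n y"
          using True y(2) by (simp add: layer_iff card_subset_eq)
        then show ?thesis
          by (metis flip_deviation)
      qed
      then show ?thesis
        using True layer_iff by blast
    next
      case False
      have "infinite (deviation n x)"
        using core False infinite_deviation_tree_point infinite_deviation_other_layer
        unfolding core_def by (metis UN_E UnE layer_iff)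
      \<comment> \<open>Fixing one deviation too many keeps the whole neighbourhood away from the
        layer.\<close>
      then obtain F where F: "finite F" "F \<subseteq> deviation n x" "card F = Suc n"
        using infinite_arbitrarily_large by metis
      have "y \<notin> layer n" if y: "y \<in> cylinder F x" for y
      proof
        assume "y \<in> layer n"
        moreover have "F \<subseteq> deviation n y"
          using y F(2) by (auto simp: cylinder_def deviation_def)
        ultimately show False
          using F(3) card_mono[of "deviation n y" F] by (auto simp: layer_iff)
      qed
      then show ?thesis
        using F(1) by blast
    qed
    then obtain F where "finite F" "cylinder F x \<inter> layer n \<subseteq> {x}"
      by blast
    then show ?thesis
      using core openin_cylinder[of F x]
      by (intro exI[of _ "cylinder F x \<inter> core"]) (auto simp: cylinder_def)
  qed
qed

section \<open>Two dense sets and their interaction\<close>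

definition layers :: "point set" where
  "layers = (\<Union>n. layer n) \<union> isolated_points"

lemma dense_layers: "dense_subset sum_space layers"
  unfolding dense_subset_iff
proof (intro conjI allI impI)
  show "layers \<subseteq> topspace sum_space"
    by (auto simp: layers_def topspace_sum_space core_def)
  fix U assume U: "openin sum_space U \<and> U \<noteq> {}"
  show "layers \<inter> U \<noteq> {}"
  proof (cases "isolated_points \<inter> U = {}")
    case True
    then obtain F x where F: "finite F" "cylinder F x \<inter> core \<subseteq> U"
      using U openin_sum_space_meets by metis
    then obtain y where "y \<in> layer (card F)" "y \<in> cylinder F x"
      using layer_meets_cylinder by blast
    then show ?thesis
      using F by (auto simp: layers_def core_def)
  qed (auto simp: layers_def)
qed

lemma sigma_closed_discrete_layers: "sigma_closed_discrete sum_space layers"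
  unfolding sigma_closed_discrete_def layers_def
  using closed_discrete_layer closed_discrete_isolated
  by (intro exI[of _ "insert isolated_points (range layer)"]) auto

lemma dense_tree_points: "dense_subset sum_space (tree_points \<union> isolated_points)"
  unfolding dense_subset_iff
proof (intro conjI allI impI)
  show "tree_points \<union> isolated_points \<subseteq> topspace sum_space"
    by (auto simp: topspace_sum_space core_def)
  fix U assume U: "openin sum_space U \<and> U \<noteq> {}"
  show "(tree_points \<union> isolated_points) \<inter> U \<noteq> {}"
  proof (cases "isolated_points \<inter> U = {}")
    case True
    then obtain F x where F: "finite F" "cylinder F x \<inter> core \<subseteq> U"
      using U openin_sum_space_meets by metis
    then obtain y where "y \<in> tree_points" "y \<in> cylinder F x"
      using tree_points_meet_cylinder by blast
    then show ?thesis
      using F by (auto simp: core_def)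
  qed auto
qed

lemma isolated_subset_dense:
  assumes "dense_subset sum_space S"
  shows "isolated_points \<subseteq> S"
proof
  fix x assume "x \<in> isolated_points"
  then have "S \<inter> {x} \<noteq> {}"
    using assms openin_isolated unfolding dense_subset_iff by blast
  then show "x \<in> S"
    by blast
qed

text \<open>An infinite intersection would accumulate at a tree point, hence at a point of the
  space, which a closed discrete set cannot do.\<close>

lemma finite_closed_discrete_tree_points:
  assumes "closed_discrete sum_space C"
  shows "finite (C \<inter> tree_points)"
proof (rule ccontr)
  assume "infinite (C \<inter> tree_points)"
  then obtain y where y: "y \<in> tree_points" "accumulates (C \<inter> tree_points) y"
    using tree_points_countably_compact[of "C \<inter> tree_points"] by blast
  have "y \<in> core"
    using y(1) by (simp add: core_def)
  then obtain U where U: "openin sum_space U" "y \<in> U" "U \<inter> C \<subseteq> {y}"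
    using assms unfolding closed_discrete_iff topspace_sum_space by (metis UnI1)
  then obtain F where F: "finite F" "cylinder F y \<inter> core \<subseteq> U"
    using \<open>y \<in> core\<close> unfolding openin_sum_space by (metis IntI)
  obtain z where "z \<in> C \<inter> tree_points" "z \<noteq> y" "z \<in> cylinder F y"
    using y(2) F(1) unfolding accumulates_def by blast
  then show False
    using U F by (auto simp: core_def)
qed

section \<open>Cardinal invariants of the space\<close>

lemma card_of_isolated_points: "|isolated_points| =o |UNIV :: real set|"
proof -
  have "inj (\<lambda>r. flip 2 {{r}})"
    using inj_flip by (metis (no_types, lifting) injD injI singleton_inject)
  then show ?thesis
    unfolding isolated_points_def
    by (meson card_of_ordIsoI inj_on_imp_bij_betw ordIso_symmetric)
qed

lemma card_of_layer: "|layer n| \<le>o |UNIV :: real set set|"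
proof -
  have "|layer n| \<le>o |{G :: real set set. finite G}|"
    unfolding layer_def
    by (rule ordLeq_transitive[OF card_of_image card_of_mono1]) auto
  then show ?thesis
    using card_of_finite_subsets[OF infinite_real_sets] ordLeq_transitive by blast
qed

text \<open>Flipping one coordinate at a time gives a point for each coordinate; this closed
  discrete layer bounds extent and weight from below.\<close>

lemma card_of_layer_1: "|UNIV :: real set set| \<le>o |layer 1|"
proof (rule card_of_ordLeqI)
  show "inj (\<lambda>A. flip 1 {A})"
    using inj_flip by (metis (no_types, lifting) injD injI singleton_inject)
qed (auto simp: layer_iff)

lemma card_of_isolated_points_ordLeq: "|isolated_points| \<le>o |UNIV :: real set set|"
  using card_of_isolated_points card_of_reals_ordLess
  by (meson ordIso_ordLess_trans ordLess_imp_ordLeq)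

lemma card_of_nat_ordLeq: "|UNIV :: nat set| \<le>o |UNIV :: real set set|"
  using infinite_real_sets by (simp add: infinite_iff_card_of_nat)

lemma card_of_layers: "|layers| \<le>o |UNIV :: real set set|"
  unfolding layers_def
  by (intro card_of_Un_ordLeq card_of_UNION_ordLeq_infinite ballI infinite_real_sets
      card_of_layer card_of_isolated_points_ordLeq card_of_nat_ordLeq)

lemma card_of_clopen_base: "|clopen_base| \<le>o |UNIV :: real set set|"
proof -
  let ?fin = "{F :: real set set. finite F}"
  \<comment> \<open>Only the values of \<open>x\<close> on \<open>F\<close> matter, so a cylinder is
    coded by two finite sets: \<open>F\<close> and the part of it where \<open>x\<close> is
    true.\<close>
  let ?c = "\<lambda>(F, G). cylinder F (\<lambda>A. A \<in> G) \<inter> core"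
  have "{cylinder F x \<inter> core | F x. finite F} \<subseteq> ?c ` (?fin \<times> ?fin)"
  proof clarify
    fix F :: "real set set" and x assume "finite F"
    moreover have "cylinder F x = cylinder F (\<lambda>A. A \<in> {B\<in>F. x B})"
      by (auto simp: cylinder_def)
    ultimately show "cylinder F x \<inter> core \<in> ?c ` (?fin \<times> ?fin)"
      by (intro image_eqI[of _ _ "(F, {B\<in>F. x B})"]) auto
  qed
  then have "|{cylinder F x \<inter> core | F x. finite F}| \<le>o |?fin \<times> ?fin|"
    by (meson card_of_image card_of_mono1 ordLeq_transitive)
  moreover have "|?fin \<times> ?fin| \<le>o |UNIV :: real set set|"
    by (intro card_of_Sigma_ordLeq_infinite ballI infinite_real_sets card_of_finite_subsets)
  moreover have "|(\<lambda>x. {x}) ` isolated_points| \<le>o |UNIV :: real set set|"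
    using card_of_image card_of_isolated_points_ordLeq ordLeq_transitive by blast
  ultimately show ?thesis
    unfolding clopen_base_def
    by (intro card_of_Un_ordLeq infinite_real_sets) (auto intro: ordLeq_transitive)
qed

lemma card_of_topspace: "|topspace sum_space| \<le>o |UNIV :: real set set|"
proof -
  have "|tree_points| \<le>o |UNIV :: real set set|"
    using card_of_tree_points card_of_reals_ordLess by (meson ordLeq_transitive ordLess_imp_ordLeq)
  then have "|tree_points \<union> layers| \<le>o |UNIV :: real set set|"
    by (intro card_of_Un_ordLeq infinite_real_sets card_of_layers)
  moreover have "topspace sum_space = tree_points \<union> layers"
    by (auto simp: topspace_sum_space core_def layers_def)
  ultimately show ?thesis
    by simp
qed

text \<open>
  A small dense \<open>\<sigma>\<close>-closed-discrete set would have countably many tree points, and its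
  other points would agree with one of countably many backgrounds outside a small set of
  coordinates. So there are two coordinates that none of its members in \<open>core\<close> separates.
\<close>

lemma card_of_dense_sigma_closed_discrete:
  assumes dense: "dense_subset sum_space Y" and sigma: "sigma_closed_discrete sum_space Y"
  shows "|UNIV :: real set set| \<le>o |Y|"
proof (rule ccontr)
  assume "\<not> |UNIV :: real set set| \<le>o |Y|"
  then have small: "|Y| <o |UNIV :: real set set|"
    by (simp add: not_ordLeq_iff_ordLess card_of_Well_order)
  obtain \<D> where D: "countable \<D>" "\<forall>C\<in>\<D>. closed_discrete sum_space C" "Y = \<Union>\<D>"
    using sigma unfolding sigma_closed_discrete_def by blast
  have "Y \<inter> tree_points = (\<Union>C\<in>\<D>. C \<inter> tree_points)"
    using D(3) by blast
  moreover have "countable (\<Union>C\<in>\<D>. C \<inter> tree_points)"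
    using D(1,2) finite_closed_discrete_tree_points by (intro countable_UN) (auto intro: countable_finite)
  ultimately have "countable (Y \<inter> tree_points)"
    by simp
  \<comment> \<open>Off the set \<open>S\<close> defined below, each core point of \<open>Y\<close>
    agrees with an element of \<open>M\<close>: with itself if it is a tree point, otherwise with
    its background.\<close>
  define M where "M = (Y \<inter> tree_points) \<union> range background"
  have M: "countable M"
    using \<open>countable (Y \<inter> tree_points)\<close> by (simp add: M_def)
  \<comment> \<open>At most one background is within finitely many deviations of \<open>x\<close>;
    \<open>K x\<close> is that set of deviations, and it is empty for tree points.\<close>
  define K where "K x = (\<Union>n. if finite (deviation n x) then deviation n x else {})" for x
  define S where "S = (\<Union>x\<in>Y. K x)"
  have nat: "|UNIV :: nat set| <o |UNIV :: real set set|"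
    using card_of_reals_ordLess infinite_UNIV_char_0[where ?'a = real]
    by (meson infinite_iff_card_of_nat ordLeq_ordLess_trans)
  have S: "|S| <o |UNIV :: real set set|"
  proof -
    \<comment> \<open>The summand of naturals makes the bound infinite whatever the size of
      \<open>Y\<close>.\<close>
    let ?B = "Y <+> (UNIV :: nat set)"
    have "countable (K x)" for x
      unfolding K_def by (intro countable_UN) (auto simp: countable_finite)
    then have "|K x| \<le>o |UNIV :: nat set|" for x
      by (meson card_of_ordLeq countable_def subset_UNIV)
    then have "|K x| \<le>o |?B|" for x
      using card_of_Plus2 ordLeq_transitive by blast
    then have "|S| \<le>o |?B|"
      unfolding S_def by (intro card_of_UNION_ordLeq_infinite ballI card_of_Plus1) simp_all
    moreover have "|?B| <o |UNIV :: real set set|"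
      by (intro card_of_Plus_ordLess_infinite infinite_real_sets small nat)
    ultimately show ?thesis
      by (rule ordLeq_ordLess_trans)
  qed
  define T where "T A = {m\<in>M. m A}" for A
  \<comment> \<open>The countable set \<open>M\<close> has at most c subsets, while 2^c coordinates
    remain outside \<open>S\<close>.\<close>
  have "\<not> inj_on T (- S)"
  proof
    assume "inj_on T (- S)"
    then have "|- S| \<le>o |Pow M|"
      by (rule card_of_ordLeqI) (auto simp: T_def)
    moreover have "|Pow M| \<le>o |UNIV :: nat set set|"
      using inj_on_image_Pow[OF inj_on_to_nat_on[OF M]] by (intro card_of_ordLeqI) auto
    ultimately have "|- S| \<le>o |UNIV :: real set|"
      using card_of_reals by (meson ordIso_symmetric ordLeq_ordIso_trans ordLeq_transitive)
    then have "|- S| <o |UNIV :: real set set|"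
      using card_of_reals_ordLess ordLeq_ordLess_trans by blast
    then have "|S \<union> - S| <o |UNIV :: real set set|"
      by (intro card_of_Un_ordLess_infinite infinite_real_sets S)
    then show False
      by (simp add: ordLess_irreflexive)
  qed
  then obtain A B where AB: "A \<notin> S" "B \<notin> S" "A \<noteq> B" "T A = T B"
    by (meson ComplD inj_onI)
  have eq: "m A = m B" if "m \<in> M" for m
    using AB(4) that unfolding T_def by blast
  \<comment> \<open>Points of this open set are true at \<open>A\<close> and false at
    \<open>B\<close>. It avoids the isolated points, so only core members of \<open>Y\<close> can
    meet it.\<close>
  let ?O = "cylinder {A, B} (\<lambda>C. C = A) \<inter> core"
  have "?O \<noteq> {}"
    using tree_points_meet_cylinder[of "{A, B}"] by (auto simp: core_def)
  then have "Y \<inter> ?O \<noteq> {}"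
    using dense openin_cylinder[of "{A, B}"] unfolding dense_subset_iff by blast
  then obtain y where y: "y \<in> Y" "y \<in> core" "y A" "\<not> y B"
    using AB(3) by (auto simp: cylinder_def)
  then have "y \<notin> tree_points"
    using eq[of y] by (auto simp: M_def)
  then obtain n where "finite (deviation n y)"
    using y(2) by (auto simp: core_def layer_iff)
  then have "deviation n y \<subseteq> S"
    using y(1) by (auto simp: S_def K_def)
  then have "y A = background n A" "y B = background n B"
    using AB by (auto simp: deviation_def)
  then show False
    using eq[of "background n"] y by (simp add: M_def)
qed

section \<open>Values of the four cardinal functions\<close>

lemma top_density_sum_space: "top_density sum_space =o |UNIV :: real set|"
proof -
  have "|tree_points \<union> isolated_points| \<le>o |UNIV :: real set|"
    using card_of_isolated_points card_of_tree_points infinite_UNIV_char_0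
    by (intro card_of_Un_ordLeq) (auto intro: ordIso_imp_ordLeq)
  \<comment> \<open>Every dense set contains all isolated points.\<close>
  moreover have le: "|UNIV :: real set| \<le>o |S|" if "dense_subset sum_space S" for S
    using isolated_subset_dense[OF that] card_of_isolated_points
    by (meson card_of_mono1 ordIso_ordLeq_trans ordIso_symmetric)
  ultimately have "top_density sum_space =o |tree_points \<union> isolated_points|"
    unfolding top_density_def
    by (intro least_card_ordIso) (auto simp: dense_tree_points intro: ordLeq_transitive)
  then show ?thesis
    using \<open>|tree_points \<union> isolated_points| \<le>o |UNIV :: real set|\<close> le[OF dense_tree_points]
    by (meson ordIso_iff_ordLeq ordIso_transitive)
qed

lemma e_density_sum_space: "e_density sum_space =o |UNIV :: real set set|"
proof -
  have "e_density sum_space =o |layers|"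
    unfolding e_density_def
    by (intro least_card_ordIso)
      (auto simp: dense_layers sigma_closed_discrete_layers
        intro: ordLeq_transitive[OF card_of_layers] card_of_dense_sigma_closed_discrete)
  moreover have "|layers| =o |UNIV :: real set set|"
    using card_of_layers dense_layers sigma_closed_discrete_layers
    by (simp add: ordIso_iff_ordLeq card_of_dense_sigma_closed_discrete)
  ultimately show ?thesis
    by (rule ordIso_transitive)
qed

lemma card_of_layer_1_ordIso: "|layer 1| =o |UNIV :: real set set|"
  using card_of_layer card_of_layer_1 by (simp add: ordIso_iff_ordLeq)

text \<open>The supremum is attained at \<open>layer 1\<close>, since the whole space is no
  larger.\<close>

lemma top_extent_sum_space: "top_extent sum_space =o |UNIV :: real set set|"
proof -
  have "|C| \<le>o |layer 1|" if "closed_discrete sum_space C" for C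
  proof -
    have "|C| \<le>o |topspace sum_space|"
      using that by (simp add: closed_discrete_iff card_of_mono1)
    then show ?thesis
      using card_of_topspace card_of_layer_1 by (meson ordLeq_transitive)
  qed
  then have "top_extent sum_space =o |layer 1|"
    unfolding top_extent_def
    by (intro least_card_ordIso) (auto simp: closed_discrete_layer)
  then show ?thesis
    using card_of_layer_1_ordIso by (rule ordIso_transitive)
qed

text \<open>A base needs a separate member for each point of \<open>layer 1\<close>, and
  \<open>clopen_base\<close> has no more members than there are coordinates.\<close>

lemma top_weight_sum_space: "top_weight sum_space =o |UNIV :: real set set|"
proof -
  have le: "|UNIV :: real set set| \<le>o |\<B>|" if "base_of sum_space \<B>" for \<B>
    using card_of_layer_1 card_of_closed_discrete_ordLeq_base[OF closed_discrete_layer that]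
    by (rule ordLeq_transitive)
  then have "top_weight sum_space =o |clopen_base|"
    unfolding top_weight_def
    by (intro least_card_ordIso)
      (auto simp: base_of_clopen_base intro: ordLeq_transitive[OF card_of_clopen_base])
  moreover have "|clopen_base| =o |UNIV :: real set set|"
    using card_of_clopen_base le[OF base_of_clopen_base] by (simp add: ordIso_iff_ordLeq)
  ultimately show ?thesis
    by (rule ordIso_transitive)
qed

theorem theorem4p2:
  shows "\<exists>X :: point topology.
           t1_space X \<and> zero_dimensional X \<and> e_separable X \<and>
           continuum =o top_density X \<and>
           top_density X <o e_density X \<and>
           e_density X =o top_extent X \<and>
           top_extent X =o top_weight X \<and>
           top_weight X =o ctwo ^c continuum"
proof (intro exI[of _ sum_space] conjI)
  show "e_separable sum_space"
    using dense_layers sigma_closed_discrete_layers e_separable_def by blast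
  show "continuum =o top_density sum_space"
    using continuum_ordIso_reals top_density_sum_space by (meson ordIso_symmetric ordIso_transitive)
  show "top_density sum_space <o e_density sum_space"
    using top_density_sum_space card_of_reals_ordLess e_density_sum_space
    by (meson ordIso_ordLess_trans ordIso_symmetric ordLess_ordIso_trans)
  show "e_density sum_space =o top_extent sum_space"
    using e_density_sum_space top_extent_sum_space by (meson ordIso_symmetric ordIso_transitive)
  show "top_extent sum_space =o top_weight sum_space"
    using top_extent_sum_space top_weight_sum_space by (meson ordIso_symmetric ordIso_transitive)
  show "top_weight sum_space =o ctwo ^c continuum"
    using top_weight_sum_space ctwo_cexp_continuum_ordIso
    by (meson ordIso_symmetric ordIso_transitive)
qed (fact t1_sum_space zero_dimensional_sum_space)+

end
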